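(* Let $I\subset\mathbb{R}$ be an interval with $0\in I$ and let $\eta\in\{-1,1\}$. For a continuous function $H:I\to\mathbb{R}$ put $$f_1(s)=\int_0^s\sinh\Big(2\eta\int_0^tH(u)\,du\Big)dt,\qquad g_1(s)=\int_0^s\cosh\Big(2\eta\int_0^tH(u)\,du\Big)dt,$$ and for $\mathbf a=(a_1,a_2,a_3)\in\mathbb{R}^3$ put $$\alpha(s;H,\mathbf a)=\Big(\sqrt{\eta[(g_1+\eta a_1)^2-(f_1+\eta a_2)^2]}\,,\;0\,,\;\int_0^s\eta\,\frac{g_1'(f_1+\eta a_2)-f_1'(g_1+\eta a_1)}{\sqrt{\eta[(g_1+\eta a_1)^2-(f_1+\eta a_2)^2]}}\,dt+a_3\Big).$$ (i) Let $\alpha(s)=(x(s),0,z(s))$, $s\in I$, with $x>0$ and $x'^2-z'^2=\eta$, be the generating curve of a $C^2$ surface of revolution in $\mathbb{E}_1^3$ with timelike axis $Oz$ and $C^0$ mean curvature $H(s)$. Then $\alpha(s)=\alpha(s;H,\mathbf a)$, where the constant vector $\mathbf a=(a_1,a_2,a_3)$ satisfies the initial conditions at $s=0$ given by $\alpha(0)=(\sqrt{\eta(a_1^2-a_2^2)},0,a_3)$ and $\alpha'(0)=[\eta(a_1^2-a_2^2)]^{-1/2}(a_1,0,a_2)$. (ii) Conversely, given a continuous function $H(s)$, $s\in I$, and a constant vector $(a_1,a_2,a_3)\in S_1\times\mathbb{R}$, where $$S_1=\bigcup_{s\in I}\{(X,Y):\ [X+\eta g_1(s)]^2-[Y+\eta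 f_1(s)]^2\neq0\},$$ the $C^2$ curve $\alpha(s;H(s),\mathbf a)$ generates a $C^2$ surface of revolution with $C^0$ mean curvature $H(s)$ when rotated around the (timelike) $z$-axis.
   Context: $\mathbb{E}_1^3$ is $\mathbb{R}^3$ with coordinates $(x,y,z)$ and the metric $\langle u,v\rangle=u_1v_1+u_2v_2-u_3v_3$. A vector $v$ is spacelike if $\langle v,v\rangle>0$ or $v=0$, timelike if $\langle v,v\rangle<0$, lightlike if $\langle v,v\rangle=0$, $v\neq0$. Arc-length parametrization of a non-lightlike curve means $\langle\alpha',\alpha'\rangle=\eta\in\{-1,1\}$. Rotating $\alpha(s)=(x(s),0,z(s))$, $x>0$, around the $z$-axis gives the surface of revolution $$Z(s,\theta)=(x(s)\cos\theta,x(s)\sin\theta,z(s)),$$ with unit normal chosen as $N=(-z'\cos\theta,-z'\sin\theta,-x')$. For a non-lightlike parametrized surface $X(u,v)$ with unit normal $N$, put $\epsilon=\langle N,N\rangle\in\{-1,1\}$ ($\epsilon=-1$ for spacelike, $+1$ for timelike surfaces), $g_{11}=\langle X_u,X_u\rangle$, $g_{12}=\langle X_u,X_v\rangle$, $g_{22}=\langle X_v,X_v\rangle$, $h_{11}=\langle X_{uu},N\rangle$, $h_{12}=\langle X_{uv},N\rangle$, $h_{22}=\langle X_{vv},N\rangle$. The mean curvature is $$H=\frac{\epsilon}{2}\,\frac{g_{11}h_{22}-2g_{12}h_{12}+g_{22}h_{11}}{g_{11}g_{22}-g_{12}^2}.$$ For the surface $Z$ the mean curvature depends only on $s$, and $\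epsilon=-\eta$.
   Formalization: Part (ii) is proved for the curve on the set of s in I where η[(g_1+ηa_1)²-(f_1+ηa_2)²]>0, not on all of I: membership in S_1 does not ensure positivity (H=0, η=1, a=0, I=ℝ gives x=|s|, not C² at 0). *)

theory Defs
  imports "HOL-Analysis.Analysis"
begin

definition lorentz :: "real^3 \<Rightarrow> real^3 \<Rightarrow> real" where
  "lorentz u v = u$1 * v$1 + u$2 * v$2 - u$3 * v$3"

text \<open>
  Derivatives are taken within the parameter set, so that they are one-sided at end points
  belonging to it. All parameter sets considered below have no isolated points, hence these
  derivatives are unique.
\<close>

definition D :: "real set \<Rightarrow> (real \<Rightarrow> 'a::real_normed_vector) \<Rightarrow> real \<Rightarrow> 'a" where
  "D I f s = vector_derivative f (at s within I)"

definition D1 :: "real set \<Rightarrow> (real \<Rightarrow> real \<Rightarrow> real^3) \<Rightarrow> real \<Rightarrow> real \<Rightarrow> real^3" where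
  "D1 U X u v = D U (\<lambda>u. X u v) u"

definition D2 :: "real set \<Rightarrow> (real \<Rightarrow> real \<Rightarrow> real^3) \<Rightarrow> real \<Rightarrow> real \<Rightarrow> real^3" where
  "D2 V X u v = D V (\<lambda>v. X u v) v"

definition C1_curve :: "real set \<Rightarrow> (real \<Rightarrow> real^3) \<Rightarrow> bool" where
  "C1_curve I \<alpha> \<longleftrightarrow> (\<forall>s\<in>I. \<alpha> differentiable (at s within I)) \<and> continuous_on I (D I \<alpha>)"

definition C2_curve :: "real set \<Rightarrow> (real \<Rightarrow> real^3) \<Rightarrow> bool" where
  "C2_curve I \<alpha> \<longleftrightarrow> C1_curve I \<alpha> \<and> C1_curve I (D I \<alpha>)"

definition C1_surface :: "real set \<Rightarrow> real set \<Rightarrow> (real \<Rightarrow> real \<Rightarrow> real^3) \<Rightarrow> bool" where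
  "C1_surface U V X \<longleftrightarrow>
     (\<forall>u\<in>U. \<forall>v\<in>V. (\<lambda>u. X u v) differentiable (at u within U)
                  \<and> (\<lambda>v. X u v) differentiable (at v within V))
   \<and> continuous_on (U \<times> V) (\<lambda>(u, v). D1 U X u v)
   \<and> continuous_on (U \<times> V) (\<lambda>(u, v). D2 V X u v)"

definition C2_surface :: "real set \<Rightarrow> real set \<Rightarrow> (real \<Rightarrow> real \<Rightarrow> real^3) \<Rightarrow> bool" where
  "C2_surface U V X \<longleftrightarrow>
     C1_surface U V X \<and> C1_surface U V (D1 U X) \<and> C1_surface U V (D2 V X)"

text \<open>
  Mean curvature at \<open>(u, v)\<close> of the parametrized surface \<open>X\<close> on \<open>U \<times> V\<close> with respect to the
  unit normal field \<open>N\<close>; \<open>lorentz (N u v) (N u v)\<close> is the sign \<open>\<epsilon>\<close>.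
\<close>

definition mean_curvature ::
    "real set \<Rightarrow> real set \<Rightarrow> (real \<Rightarrow> real \<Rightarrow> real^3) \<Rightarrow> (real \<Rightarrow> real \<Rightarrow> real^3)
      \<Rightarrow> real \<Rightarrow> real \<Rightarrow> real" where
  "mean_curvature U V X N u v =
    (let \<epsilon> = lorentz (N u v) (N u v);
         g11 = lorentz (D1 U X u v) (D1 U X u v);
         g12 = lorentz (D1 U X u v) (D2 V X u v);
         g22 = lorentz (D2 V X u v) (D2 V X u v);
         h11 = lorentz (D1 U (D1 U X) u v) (N u v);
         h12 = lorentz (D2 V (D1 U X) u v) (N u v);
         h22 = lorentz (D2 V (D2 V X) u v) (N u v)
     in \<epsilon> / 2 * ((g11 * h22 - 2 * g12 * h12 + g22 * h11) / (g11 * g22 - g12\<^sup>2)))"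

text \<open>
  A generating curve \<open>\<alpha> = (x, 0, z)\<close> is a map into \<open>real^3\<close> with vanishing second component.
\<close>

definition rot_surface :: "(real \<Rightarrow> real^3) \<Rightarrow> real \<Rightarrow> real \<Rightarrow> real^3" where
  "rot_surface \<alpha> s \<theta> = vector [\<alpha> s $ 1 * cos \<theta>, \<alpha> s $ 1 * sin \<theta>, \<alpha> s $ 3]"

definition rot_normal :: "real set \<Rightarrow> (real \<Rightarrow> real^3) \<Rightarrow> real \<Rightarrow> real \<Rightarrow> real^3" where
  "rot_normal I \<alpha> s \<theta> =
     vector [- (D I \<alpha> s $ 3) * cos \<theta>, - (D I \<alpha> s $ 3) * sin \<theta>, - (D I \<alpha> s $ 1)]"

text \<open>
  \<open>generates I \<eta> H \<alpha>\<close>: on \<open>I\<close>, \<open>\<alpha>\<close> is a \<open>C\<^sup>2\<close> curve \<open>(x, 0, z)\<close> with \<open>x > 0\<close>, parametrized by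
  arc length with causal character \<open>\<eta>\<close>, and rotating it around the \<open>z\<close>-axis yields a \<open>C\<^sup>2\<close>
  surface with continuous mean curvature \<open>H s\<close>.
\<close>

definition generates :: "real set \<Rightarrow> real \<Rightarrow> (real \<Rightarrow> real) \<Rightarrow> (real \<Rightarrow> real^3) \<Rightarrow> bool" where
  "generates I \<eta> H \<alpha> \<longleftrightarrow>
     C2_curve I \<alpha>
   \<and> (\<forall>s\<in>I. \<alpha> s $ 2 = 0 \<and> \<alpha> s $ 1 > 0)
   \<and> (\<forall>s\<in>I. lorentz (D I \<alpha> s) (D I \<alpha> s) = \<eta>)
   \<and> C2_surface I UNIV (rot_surface \<alpha>)
   \<and> continuous_on I H
   \<and> (\<forall>s\<in>I. \<forall>\<theta>. mean_curvature I UNIV (rot_surface \<alpha>) (rot_normal I \<alpha>) s \<theta> = H s)"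

definition f1 :: "real \<Rightarrow> (real \<Rightarrow> real) \<Rightarrow> real \<Rightarrow> real" where
  "f1 \<eta> H s = (LBINT t=0..s. sinh (2 * \<eta> * (LBINT u=0..t. H u)))"

definition g1 :: "real \<Rightarrow> (real \<Rightarrow> real) \<Rightarrow> real \<Rightarrow> real" where
  "g1 \<eta> H s = (LBINT t=0..s. cosh (2 * \<eta> * (LBINT u=0..t. H u)))"

definition radicand :: "real \<Rightarrow> (real \<Rightarrow> real) \<Rightarrow> real^3 \<Rightarrow> real \<Rightarrow> real" where
  "radicand \<eta> H a s = \<eta> * ((g1 \<eta> H s + \<eta> * a$1)\<^sup>2 - (f1 \<eta> H s + \<eta> * a$2)\<^sup>2)"

definition curve :: "real set \<Rightarrow> real \<Rightarrow> (real \<Rightarrow> real) \<Rightarrow> real^3 \<Rightarrow> real \<Rightarrow> real^3" where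
  "curve I \<eta> H a s =
     vector [sqrt (radicand \<eta> H a s),
             0,
             (LBINT t=0..s. \<eta> * ((D I (g1 \<eta> H) t * (f1 \<eta> H t + \<eta> * a$2)
                                   - D I (f1 \<eta> H) t * (g1 \<eta> H t + \<eta> * a$1))
                                  / sqrt (radicand \<eta> H a t))) + a$3]"

text \<open>
  The formula for \<open>curve\<close> describes a real curve with positive first component exactly on the
  following relatively open subset of \<open>I\<close>. If the segment from \<open>0\<close> to a point \<open>s\<close> of this
  set leaves the set, then the part of the third component coming from outside the set
  (where \<open>sqrt\<close> of a negative number is negative by convention) is still an absolutely
  convergent integral, which is locally constant in \<open>s\<close> and so only shifts the curve along
  the \<open>z\<close>-axis.
\<close>

definition curve_domain :: "real set \<Rightarrow> real \<Rightarrow> (real \<Rightarrow> real) \<Rightarrow> real^3 \<Rightarrow> real set" where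
  "curve_domain I \<eta> H a = {s \<in> I. radicand \<eta> H a s > 0}"

definition S1 :: "real set \<Rightarrow> real \<Rightarrow> (real \<Rightarrow> real) \<Rightarrow> (real \<times> real) set" where
  "S1 I \<eta> H = (\<Union>s\<in>I. {(X, Y). (X + \<eta> * g1 \<eta> H s)\<^sup>2 - (Y + \<eta> * f1 \<eta> H s)\<^sup>2 \<noteq> 0})"

definition initial_conditions :: "real set \<Rightarrow> real \<Rightarrow> (real \<Rightarrow> real^3) \<Rightarrow> real^3 \<Rightarrow> bool" where
  "initial_conditions I \<eta> \<alpha> a \<longleftrightarrow>
     \<alpha> 0 = vector [sqrt (\<eta> * ((a$1)\<^sup>2 - (a$2)\<^sup>2)), 0, a$3]
   \<and> D I \<alpha> 0 = (\<eta> * ((a$1)\<^sup>2 - (a$2)\<^sup>2)) powr (- 1/2) *\<^sub>R vector [a$1, 0, a$2]"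

end

theory Submission
  imports Defs
begin

text \<open>
  For a unit-speed profile curve the mean curvature equation and \<open>x'\<^sup>2 - z'\<^sup>2 = \<eta>\<close> turn into the
  decoupled linear equations \<open>(x (x' \<plusminus> z'))' = \<eta> \<mp> \<phi>' x (x' \<plusminus> z')\<close> with \<open>\<phi>' = 2 \<eta> H\<close>. Integrating them
  gives \<open>x (x' + z') = \<eta> exp (- \<phi>) P\<close> and \<open>x (x' - z') = \<eta> exp \<phi> Q\<close>, where \<open>P' = exp \<phi>\<close> and
  \<open>Q' = exp (- \<phi>)\<close>. Multiplying yields \<open>x\<^sup>2 = \<eta> P Q\<close>, the radicand, and subtracting yields \<open>z'\<close>.
  Conversely, this \<open>x\<close> and \<open>z'\<close> satisfy the equations where \<open>\<eta> P Q > 0\<close>. The integral defining \<open>z\<close>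
  may run through zeros of the radicand, but there the integrand is bounded by a multiple of
  \<open>Q' / sqrt \<bar>Q\<bar> + P' / sqrt \<bar>P\<bar>\<close>, which is integrable because \<open>P\<close> and \<open>Q\<close> are monotone.
\<close>

subsection \<open>Rotated curves\<close>

lemma vector_3_eq_axes:
  "(vector [a, b, c] :: real^3) = a *\<^sub>R axis 1 1 + b *\<^sub>R axis 2 1 + c *\<^sub>R axis 3 1"
  by (simp add: vec_eq_iff forall_3 axis_def)

lemma has_vector_derivative_vector_3:
  assumes "(x has_real_derivative x') (at t within S)" "(y has_real_derivative y') (at t within S)" "(z has_real_derivative z') (at t within S)"
  shows "((\<lambda>s. vector [x s, y s, z s] :: real^3) has_vector_derivative vector [x', y', z']) (at t within S)"
  unfolding vector_3_eq_axes
  by (rule has_vector_derivative_eq_rhs, (rule has_vector_derivative_add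
        has_vector_derivative_scaleR assms has_vector_derivative_const)+) simp

lemma continuous_on_vector_3 [continuous_intros]:
  assumes "continuous_on S x" "continuous_on S y" "continuous_on S z"
  shows "continuous_on S (\<lambda>s. vector [x s, y s, z s] :: real^3)"
  unfolding vector_3_eq_axes by (intro continuous_intros assms)

lemma has_vector_derivative_vec_nth:
  assumes "(\<alpha> has_vector_derivative \<alpha>') F"
  shows "((\<lambda>s. \<alpha> s $ i) has_real_derivative \<alpha>' $ i) F"
  using bounded_linear.has_vector_derivative[OF bounded_linear_vec_nth assms, of i]
  by (simp add: has_real_derivative_iff_has_vector_derivative)

section \<open>Derivatives within a set, curves and surfaces of class C1 and C2\<close>

lemma D_eqI:
  assumes "(f has_vector_derivative f') (at s within U)" "s islimpt U"
  shows "D U f s = f'"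
  using assms by (simp add: D_def vector_derivative_within trivial_limit_within)

lemma C1_curveI:
  assumes "\<And>s. s \<in> U \<Longrightarrow> s islimpt U"
    and "\<And>s. s \<in> U \<Longrightarrow> (\<alpha> has_vector_derivative \<beta> s) (at s within U)"
    and "continuous_on U \<beta>"
  shows "C1_curve U \<alpha>"
proof -
  have "D U \<alpha> s = \<beta> s" if "s \<in> U" for s
    using D_eqI assms(1,2) that by blast
  then have "continuous_on U (D U \<alpha>)"
    using assms(3) by (simp cong: continuous_on_cong)
  then show ?thesis
    using assms(2) by (auto simp: C1_curve_def intro: differentiableI_vector)
qed

lemma C2_curveI:
  assumes limpt: "\<And>s. s \<in> U \<Longrightarrow> s islimpt U"
    and d: "\<And>s. s \<in> U \<Longrightarrow> (\<alpha> has_vector_derivative \<beta> s) (at s within U)"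
    and d': "\<And>s. s \<in> U \<Longrightarrow> (\<beta> has_vector_derivative \<gamma> s) (at s within U)"
    and "continuous_on U \<gamma>"
  shows "C2_curve U \<alpha>"
proof -
  have "(D U \<alpha> has_vector_derivative \<gamma> s) (at s within U)" if "s \<in> U" for s
    using that D_eqI d limpt by (intro has_vector_derivative_transform[OF that _ d'[OF that]]) blast
  moreover have "continuous_on U \<beta>"
    using d' by (rule continuous_on_vector_derivative)
  ultimately show ?thesis
    unfolding C2_curve_def using C1_curveI limpt d assms(4) by blast
qed

lemma C2_curveE:
  assumes "C2_curve U \<alpha>" "s \<in> U"
  shows "(\<alpha> has_vector_derivative D U \<alpha> s) (at s within U)"
    and "(D U \<alpha> has_vector_derivative D U (D U \<alpha>) s) (at s within U)"
  using assms by (auto simp: C2_curve_def C1_curve_def D_def[of U] vector_derivative_works)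

text \<open>Smoothness and the values of the partials come together: \<open>D1\<close> and
  \<open>D2\<close> must first be identified with known fields before continuity passes to them.
  Three applications of this lemma yield a C2 surface.\<close>

lemma C1_surfaceI:
  assumes limpt: "\<And>u. u \<in> U \<Longrightarrow> u islimpt U"
    and d1: "\<And>u v. u \<in> U \<Longrightarrow> ((\<lambda>u. X u v) has_vector_derivative X1 u v) (at u within U)"
    and d2: "\<And>u v. u \<in> U \<Longrightarrow> ((\<lambda>v. X u v) has_vector_derivative X2 u v) (at v)"
    and c: "continuous_on (U \<times> UNIV) (\<lambda>(u, v). X1 u v)" "continuous_on (U \<times> UNIV) (\<lambda>(u, v). X2 u v)"
  shows "C1_surface U UNIV X"
    and "\<And>u v. u \<in> U \<Longrightarrow> D1 U X u v = X1 u v"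
    and "\<And>u v. u \<in> U \<Longrightarrow> D2 UNIV X u v = X2 u v"
proof -
  show 1: "D1 U X u v = X1 u v" if "u \<in> U" for u v
    using that by (simp add: D1_def D_eqI d1 limpt)
  show 2: "D2 UNIV X u v = X2 u v" if "u \<in> U" for u v
    using that by (simp add: D2_def D_eqI d2)
  have "continuous_on (U \<times> UNIV) (\<lambda>(u, v). D1 U X u v)"
    by (rule continuous_on_eq[OF c(1)]) (auto simp: 1)
  moreover have "continuous_on (U \<times> UNIV) (\<lambda>(u, v). D2 UNIV X u v)"
    by (rule continuous_on_eq[OF c(2)]) (auto simp: 2)
  ultimately show "C1_surface U UNIV X"
    unfolding C1_surface_def using differentiableI_vector[OF d1] differentiableI_vector[OF d2] by blast
qed

text \<open>The angular partial derivative of \<open>rot_surface \<alpha>\<close>. Differentiating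
  once more in \<theta> only shifts \<theta> by a right angle, so the second angular derivative is
  again a \<open>rot_dir\<close>.\<close>

definition rot_dir :: "(real \<Rightarrow> real^3) \<Rightarrow> real \<Rightarrow> real \<Rightarrow> real^3" where
  "rot_dir \<alpha> s \<theta> = vector [- \<alpha> s $ 1 * sin \<theta>, \<alpha> s $ 1 * cos \<theta>, 0]"

lemma rot_surface_has_vector_derivative:
  assumes "(\<alpha> has_vector_derivative \<beta> s) (at s within U)"
  shows "((\<lambda>s. rot_surface \<alpha> s \<theta>) has_vector_derivative rot_surface \<beta> s \<theta>) (at s within U)"
    and "((\<lambda>\<theta>. rot_surface \<alpha> s \<theta>) has_vector_derivative rot_dir \<alpha> s \<theta>) (at \<theta>)"
  unfolding rot_surface_def rot_dir_def
  by (auto intro!: has_vector_derivative_vector_3 derivative_eq_intros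
        has_vector_derivative_vec_nth[OF assms])

lemma rot_dir_has_vector_derivative:
  assumes "(\<alpha> has_vector_derivative \<beta> s) (at s within U)"
  shows "((\<lambda>s. rot_dir \<alpha> s \<theta>) has_vector_derivative rot_dir \<beta> s \<theta>) (at s within U)"
    and "((\<lambda>\<theta>. rot_dir \<alpha> s \<theta>) has_vector_derivative rot_dir \<alpha> s (\<theta> + pi / 2)) (at \<theta>)"
  unfolding rot_dir_def
  by (auto intro!: has_vector_derivative_vector_3 derivative_eq_intros
        has_vector_derivative_vec_nth[OF assms] simp: sin_add cos_add)

text \<open>The shift \<open>c\<close> serves the first angular derivative with 0 and the second
  with \<open>pi / 2\<close>.\<close>

lemma continuous_on_rot:
  assumes "continuous_on U \<alpha>"
  shows "continuous_on (U \<times> UNIV) (\<lambda>(s, \<theta>). rot_surface \<alpha> s \<theta>)"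
    and "continuous_on (U \<times> UNIV) (\<lambda>(s, \<theta>). rot_dir \<alpha> s (\<theta> + c))"
proof -
  have "continuous_on (U \<times> UNIV) (\<lambda>p. \<alpha> (fst p))"
    by (intro continuous_on_compose2[OF assms] continuous_intros) auto
  then show "continuous_on (U \<times> UNIV) (\<lambda>(s, \<theta>). rot_surface \<alpha> s \<theta>)"
    and "continuous_on (U \<times> UNIV) (\<lambda>(s, \<theta>). rot_dir \<alpha> s (\<theta> + c))"
    by (auto simp: rot_surface_def rot_dir_def case_prod_beta intro!: continuous_intros)
qed

text \<open>Rotation is linear in the curve, so differentiating in \<open>s\<close> just replaces
  \<alpha> by \<beta> and \<beta> by \<gamma>, while \<theta> acts through \<open>rot_dir\<close>.
  All partials up to order two are thus explicit.\<close>

lemma rot_surface_C2: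
  assumes limpt: "\<And>s. s \<in> U \<Longrightarrow> s islimpt U"
    and d: "\<And>s. s \<in> U \<Longrightarrow> (\<alpha> has_vector_derivative \<beta> s) (at s within U)"
    and d': "\<And>s. s \<in> U \<Longrightarrow> (\<beta> has_vector_derivative \<gamma> s) (at s within U)"
    and cont: "continuous_on U \<gamma>"
  shows "C2_surface U UNIV (rot_surface \<alpha>)"
    and "\<And>s \<theta>. s \<in> U \<Longrightarrow> D1 U (rot_surface \<alpha>) s \<theta> = rot_surface \<beta> s \<theta>"
    and "\<And>s \<theta>. s \<in> U \<Longrightarrow> D2 UNIV (rot_surface \<alpha>) s \<theta> = rot_dir \<alpha> s \<theta>"
    and "\<And>s \<theta>. s \<in> U \<Longrightarrow> D1 U (D1 U (rot_surface \<alpha>)) s \<theta> = rot_surface \<gamma> s \<theta>"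
    and "\<And>s \<theta>. s \<in> U \<Longrightarrow> D2 UNIV (D1 U (rot_surface \<alpha>)) s \<theta> = rot_dir \<beta> s \<theta>"
    and "\<And>s \<theta>. s \<in> U \<Longrightarrow> D2 UNIV (D2 UNIV (rot_surface \<alpha>)) s \<theta> = rot_dir \<alpha> s (\<theta> + pi / 2)"
proof -
  have c: "continuous_on U \<alpha>" "continuous_on U \<beta>"
    using d d' continuous_on_vector_derivative by blast+
  have "((\<lambda>s. rot_surface \<alpha> s \<theta>) has_vector_derivative rot_surface \<beta> s \<theta>) (at s within U)"
    and "((\<lambda>\<theta>. rot_surface \<alpha> s \<theta>) has_vector_derivative rot_dir \<alpha> s \<theta>) (at \<theta>)"
    if "s \<in> U" for s \<theta>
    using rot_surface_has_vector_derivative[where s = s and \<beta> = \<beta>, OF d[OF that]] by simp_all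
  note 0 = C1_surfaceI[where X = "rot_surface \<alpha>", OF limpt this continuous_on_rot(1)[OF c(2)]
      continuous_on_rot(2)[OF c(1), of 0, simplified]]
  show 1: "D1 U (rot_surface \<alpha>) s \<theta> = rot_surface \<beta> s \<theta>"
    and 2: "D2 UNIV (rot_surface \<alpha>) s \<theta> = rot_dir \<alpha> s \<theta>" if "s \<in> U" for s \<theta>
    using 0(2,3) that by blast+
  have "((\<lambda>s. D1 U (rot_surface \<alpha>) s \<theta>) has_vector_derivative rot_surface \<gamma> s \<theta>) (at s within U)"
    and "((\<lambda>\<theta>. D1 U (rot_surface \<alpha>) s \<theta>) has_vector_derivative rot_dir \<beta> s \<theta>) (at \<theta>)"
    and "((\<lambda>s. D2 UNIV (rot_surface \<alpha>) s \<theta>) has_vector_derivative rot_dir \<beta> s \<theta>) (at s within U)"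
    and "((\<lambda>\<theta>. D2 UNIV (rot_surface \<alpha>) s \<theta>) has_vector_derivative rot_dir \<alpha> s (\<theta> + pi / 2)) (at \<theta>)"
    if "s \<in> U" for s \<theta>
    using has_vector_derivative_transform[OF that 1 rot_surface_has_vector_derivative(1)[where s = s and \<beta> = \<gamma>, OF d'[OF that]]]
      rot_surface_has_vector_derivative(2)[where s = s and \<beta> = \<gamma>, OF d'[OF that]]
      has_vector_derivative_transform[OF that 2 rot_dir_has_vector_derivative(1)[where s = s and \<beta> = \<beta>, OF d[OF that]]]
      rot_dir_has_vector_derivative(2)[where s = s and \<beta> = \<beta>, OF d[OF that]]
    by (simp_all add: 1 2 that)
  note d'' = this
  note 3 = C1_surfaceI[where ?X1.0 = "rot_surface \<gamma>" and ?X2.0 = "rot_dir \<beta>", OF limpt d''(1,2) continuous_on_rot(1)[OF cont]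
      continuous_on_rot(2)[OF c(2), of 0, simplified]]
  note 4 = C1_surfaceI[where ?X1.0 = "rot_dir \<beta>" and ?X2.0 = "\<lambda>s \<theta>. rot_dir \<alpha> s (\<theta> + pi / 2)",
      OF limpt d''(3,4) continuous_on_rot(2)[OF c(2), of 0, simplified]
      continuous_on_rot(2)[OF c(1), of "pi / 2"]]
  show "C2_surface U UNIV (rot_surface \<alpha>)"
    using 0(1) 3(1) 4(1) by (simp add: C2_surface_def)
  show "D1 U (D1 U (rot_surface \<alpha>)) s \<theta> = rot_surface \<gamma> s \<theta>"
    and "D2 UNIV (D1 U (rot_surface \<alpha>)) s \<theta> = rot_dir \<beta> s \<theta>"
    and "D2 UNIV (D2 UNIV (rot_surface \<alpha>)) s \<theta> = rot_dir \<alpha> s (\<theta> + pi / 2)" if "s \<in> U" for s \<theta>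
    using 3(2,3) 4(3) that by blast+
qed

text \<open>The coordinates are orthogonal, with \<open>g11 = \<eta>\<close> and \<open>g22\<close>
  the squared radius, and the normal has sign \<open>- \<eta>\<close>; the quotient then splits into
  the curvature of the parallel and that of the profile.\<close>

lemma rot_mean_curvature:
  assumes limpt: "\<And>s. s \<in> U \<Longrightarrow> s islimpt U"
    and d: "\<And>s. s \<in> U \<Longrightarrow> (\<alpha> has_vector_derivative \<beta> s) (at s within U)"
    and d': "\<And>s. s \<in> U \<Longrightarrow> (\<beta> has_vector_derivative \<gamma> s) (at s within U)"
    and cont: "continuous_on U \<gamma>"
    and s: "s \<in> U" and pos: "\<alpha> s $ 1 > 0"
    and arc: "(\<beta> s $ 1)\<^sup>2 - (\<beta> s $ 3)\<^sup>2 = \<eta>" and \<eta>: "\<eta> \<in> {-1, 1}"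
  shows "mean_curvature U UNIV (rot_surface \<alpha>) (rot_normal U \<alpha>) s \<theta> =
    - (\<eta> * \<beta> s $ 3 / \<alpha> s $ 1 + \<gamma> s $ 3 * \<beta> s $ 1 - \<gamma> s $ 1 * \<beta> s $ 3) / 2"
proof -
  note R = rot_surface_C2[OF limpt d d' cont]
  let ?x = "\<alpha> s $ 1" and ?x1 = "\<beta> s $ 1" and ?x2 = "\<gamma> s $ 1" and ?z1 = "\<beta> s $ 3" and ?z2 = "\<gamma> s $ 3"
  have N: "rot_normal U \<alpha> s \<theta> = vector [- ?z1 * cos \<theta>, - ?z1 * sin \<theta>, - ?x1]"
    by (simp add: rot_normal_def D_eqI[OF d[OF s] limpt[OF s]])
  have cs: "(sin \<theta>)\<^sup>2 = 1 - (cos \<theta>)\<^sup>2"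
    by (simp add: sin_squared_eq)
  have "lorentz (rot_normal U \<alpha> s \<theta>) (rot_normal U \<alpha> s \<theta>) = - \<eta>"
    unfolding N arc[symmetric] lorentz_def using cs by simp algebra
  moreover have "lorentz (rot_surface \<beta> s \<theta>) (rot_surface \<beta> s \<theta>) = \<eta>"
    unfolding arc[symmetric] lorentz_def rot_surface_def using cs by simp algebra
  moreover have "lorentz (rot_surface \<beta> s \<theta>) (rot_dir \<alpha> s \<theta>) = 0"
    unfolding lorentz_def rot_surface_def rot_dir_def by simp
  moreover have "lorentz (rot_dir \<alpha> s \<theta>) (rot_dir \<alpha> s \<theta>) = ?x\<^sup>2"
    unfolding lorentz_def rot_dir_def using cs by simp algebra
  moreover have "lorentz (rot_surface \<gamma> s \<theta>) (rot_normal U \<alpha> s \<theta>) = ?z2 * ?x1 - ?x2 * ?z1"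
    unfolding N lorentz_def rot_surface_def using cs by simp algebra
  moreover have "lorentz (rot_dir \<alpha> s (\<theta> + pi / 2)) (rot_normal U \<alpha> s \<theta>) = ?x * ?z1"
    unfolding N lorentz_def rot_dir_def using cs by (simp add: sin_add cos_add) algebra
  \<comment> \<open>The coefficient \<open>h12\<close> occurs only multiplied by
    \<open>g12 = 0\<close>, so its value is never computed.\<close>
  ultimately have "mean_curvature U UNIV (rot_surface \<alpha>) (rot_normal U \<alpha>) s \<theta> =
      - \<eta> / 2 * ((\<eta> * (?x * ?z1) + ?x\<^sup>2 * (?z2 * ?x1 - ?x2 * ?z1)) / (\<eta> * ?x\<^sup>2))"
    by (simp add: mean_curvature_def Let_def R(2-6)[OF _ _ _ s] s)
  then show ?thesis
    using pos \<eta> by (auto simp: field_simps power2_eq_square)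
qed

subsection \<open>Indefinite integrals with singularities\<close>

text \<open>The fundamental theorem of calculus is applied on compact intervals. This provides one
  inside \<open>I \<inter> T\<close> with the same filter at \<open>s\<close>, also when
  \<open>s\<close> is an end point of \<open>I\<close>, where the interval extends to one side
  only.\<close>

lemma interval_neighbourhood:
  fixes I T :: "real set"
  assumes I: "is_interval I" and T: "open T" and s: "s \<in> I \<inter> T"
  obtains a b where "s \<in> {a..b}" "{a..b} \<subseteq> I \<inter> T" "at s within {a..b} = at s within I"
proof -
  obtain e where e: "e > 0" "ball s e \<subseteq> T"
    using T s by (meson IntD2 openE)
  obtain a where a: "a \<le> s" "\<exists>y\<in>I. y \<le> a" "s - e / 2 \<le> a" "(\<exists>y\<in>I. y < s) \<Longrightarrow> a < s"
  proof (cases "\<exists>y\<in>I. y < s")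
    case True
    then obtain y where "y \<in> I" "y < s" by blast
    then show thesis using that[of "max y (s - e / 2)"] e(1) by (simp add: bexI[of _ y])
  next
    case False
    then show thesis using that[of s] s e(1) by auto
  qed
  obtain b where b: "s \<le> b" "\<exists>y\<in>I. b \<le> y" "b \<le> s + e / 2" "(\<exists>y\<in>I. s < y) \<Longrightarrow> s < b"
  proof (cases "\<exists>y\<in>I. s < y")
    case True
    then obtain y where "y \<in> I" "s < y" by blast
    then show thesis using that[of "min y (s + e / 2)"] e(1) by (simp add: bexI[of _ y])
  next
    case False
    then show thesis using that[of s] s e(1) by auto
  qed
  have sub: "{a..b} \<subseteq> I"
  proof
    fix t assume "t \<in> {a..b}"
    moreover obtain y z where "y \<in> I" "y \<le> a" "z \<in> I" "b \<le> z" using a(2) b(2) by blast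
    ultimately show "t \<in> I" by (meson I atLeastAtMost_iff mem_is_interval_1_I order_trans)
  qed
  moreover have "{a..b} \<subseteq> T"
    using a(3) b(3) e by (force simp: dist_real_def)
  moreover have "at s within {a..b} = at s within I"
  proof (rule at_within_nhd)
    \<comment> \<open>On a side of \<open>s\<close> where \<open>I\<close> has no points,
      \<open>S\<close> may reach past the compact interval without meeting \<open>I\<close>; the
      distance 1 is arbitrary.\<close>
    define S where "S = {(if \<exists>y\<in>I. y < s then a else s - 1)<..<(if \<exists>y\<in>I. s < y then b else s + 1)}"
    show "s \<in> S" using a(4) b(4) by (auto simp: S_def)
    show "open S" by (simp add: S_def)
    have "t \<in> {a..b}" if t: "t \<in> I" "t \<in> S" for t
    proof (cases t s rule: linorder_cases)
      case less
      then have "\<exists>y\<in>I. y < s" using t by blast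
      then show ?thesis using t(2) less b(1) by (simp add: S_def)
    next
      case greater
      then have "\<exists>y\<in>I. s < y" using t by blast
      then show ?thesis using t(2) greater a(1) by (simp add: S_def)
    qed (use a(1) b(1) in simp)
    then show "{a..b} \<inter> S - {s} = I \<inter> S - {s}"
      using sub by blast
  qed
  ultimately show thesis using that[of a b] a(1) b(1) by auto
qed

text \<open>The integrand is continuous only on \<open>I \<inter> T\<close>, and the path from
  \<open>c\<close> to \<open>s\<close> may leave \<open>T\<close>. Integrability allows splitting
  the integral at \<open>s\<close>: the first piece is constant, and the second is differentiated
  near \<open>s\<close>, where the integrand is continuous.\<close>

lemma LBINT_has_real_derivative:
  fixes w :: "real \<Rightarrow> real"
  assumes I: "is_interval I" "c \<in> I"
    and int: "\<And>a b. {a..b} \<subseteq> I \<Longrightarrow> a \<le> b \<Longrightarrow> interval_lebesgue_integrable lborel a b w"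
    and T: "open T" "continuous_on (I \<inter> T) w" and s: "s \<in> I \<inter> T"
  shows "((\<lambda>s. LBINT t=c..s. w t) has_real_derivative w s) (at s within I)"
proof -
  obtain a b where ab: "s \<in> {a..b}" "{a..b} \<subseteq> I \<inter> T" "at s within {a..b} = at s within I"
    using interval_neighbourhood[OF I(1) T(1) s] .
  have "((\<lambda>u. (LBINT t=c..s. w t) + (LBINT t=s..u. w t)) has_vector_derivative 0 + w s) (at s within {a..b})"
    by (intro has_vector_derivative_add has_vector_derivative_const interval_integral_FTC2
      continuous_on_subset[OF T(2) ab(2)]) (use ab(1) in auto)
  then have "((\<lambda>u. LBINT t=c..u. w t) has_vector_derivative 0 + w s) (at s within {a..b})"
  proof (rule has_vector_derivative_transform[OF ab(1), rotated])
    fix u assume "u \<in> {a..b}"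
    then have "u \<in> I" "s \<in> I" using ab(2) s by auto
    \<comment> \<open>Additivity of the interval integral, whatever the order of \<open>c\<close>,
      \<open>s\<close> and \<open>u\<close>, asks for integrability on the hull of the three
      points.\<close>
    then have "min c (min s u) \<in> I" "max c (max s u) \<in> I"
      using I(2) by (simp_all add: min_def max_def)
    then have "{min c (min s u)..max c (max s u)} \<subseteq> I"
      by (meson atLeastAtMost_iff subsetI mem_is_interval_1_I[OF I(1)])
    moreover have "min c (min s u) \<le> max c (max s u)"
      by simp
    ultimately have "interval_lebesgue_integrable lborel (min (ereal c) (min (ereal s) (ereal u)))
        (max (ereal c) (max (ereal s) (ereal u))) w"
      unfolding ereal_min[symmetric] ereal_max[symmetric] by (rule int)
    then show "(LBINT t=c..u. w t) = (LBINT t=c..s. w t) + (LBINT t=s..u. w t)"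
      by (simp add: interval_integral_sum)
  qed
  then show ?thesis
    by (simp add: has_real_derivative_iff_has_vector_derivative ab(3))
qed

lemma LBINT_has_real_derivative_continuous:
  fixes w :: "real \<Rightarrow> real"
  assumes "is_interval I" "c \<in> I" "continuous_on I w" "s \<in> I"
  shows "((\<lambda>s. LBINT t=c..s. w t) has_real_derivative w s) (at s within I)"
  by (rule LBINT_has_real_derivative[where T = UNIV])
    (use assms in \<open>auto intro!: interval_integrable_continuous_on intro: continuous_on_subset\<close>)

text \<open>Isabelle's root satisfies \<open>sqrt (- x) = - sqrt x\<close>, so \<open>2 * sqrt q\<close> is a continuous
  antiderivative of \<open>q' / sqrt \<bar>q\<bar>\<close> across the zero of \<open>q\<close>.\<close>

lemma integrable_on_deriv_over_sqrt:
  fixes q q' :: "real \<Rightarrow> real"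
  assumes "a \<le> b"
    and d: "\<And>t. t \<in> {a..b} \<Longrightarrow> (q has_real_derivative q' t) (at t within {a..b})"
    and pos: "\<And>t. t \<in> {a..b} \<Longrightarrow> q' t > 0"
  shows "(\<lambda>t. q' t / sqrt \<bar>q t\<bar>) integrable_on {a..b}"
proof -
  have cont: "continuous_on {a..b} q"
    using d by (rule DERIV_continuous_on)
  have d': "(q has_real_derivative q' t) (at t)" if "t \<in> {a<..<b}" for t
    using d[of t] that by (simp add: at_within_Icc_at)
  have less: "q x < q y" if "x \<in> {a..b}" "y \<in> {a..b}" "x < y" for x y
    using DERIV_pos_imp_increasing_open[of x y q] that d' pos continuous_on_subset[OF cont, of "{x..y}"]
    by (metis atLeastAtMost_iff atLeastatMost_subset_iff greaterThanLessThan_iff less_le_trans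
        less_imp_le order_le_less_trans)
  \<comment> \<open>Strict monotonicity leaves at most one zero. It forms the finite exceptional set
    that the strong fundamental theorem tolerates.\<close>
  have fin: "finite {t \<in> {a..b}. q t = 0}"
  proof (cases "\<exists>c\<in>{a..b}. q c = 0")
    case True
    then obtain c where "c \<in> {a..b}" "q c = 0" by blast
    then have "{t \<in> {a..b}. q t = 0} \<subseteq> {c}"
      using less by (auto, metis atLeastAtMost_iff less_irrefl linorder_neqE)
    then show ?thesis using finite_subset by blast
  next
    case False
    then have "{t \<in> {a..b}. q t = 0} = {}" by blast
    then show ?thesis by (simp only: finite.emptyI)
  qed
  have deriv: "((\<lambda>t. 2 * sqrt (q t)) has_vector_derivative q' t / sqrt \<bar>q t\<bar>) (at t)"
    if t: "t \<in> {a<..<b} - {t \<in> {a..b}. q t = 0}" for t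
  proof -
    have "q t \<noteq> 0" using t by auto
    then have "(sqrt has_real_derivative inverse (sqrt \<bar>q t\<bar>) / 2) (at (q t))"
      by (intro DERIV_real_sqrt_generic) (auto simp: real_sqrt_minus)
    from DERIV_chain2[OF this d'] t
    have "((\<lambda>t. 2 * sqrt (q t)) has_real_derivative 2 * (inverse (sqrt \<bar>q t\<bar>) / 2 * q' t)) (at t)"
      by (intro DERIV_cmult) auto
    then show ?thesis
      by (simp add: has_real_derivative_iff_has_vector_derivative field_simps)
  qed
  have "continuous_on {a..b} (\<lambda>t. 2 * sqrt (q t))"
    by (intro continuous_intros cont)
  from fundamental_theorem_of_calculus_interior_strong[OF fin \<open>a \<le> b\<close> deriv this]
  show ?thesis by (rule has_integral_integrable)
qed

text \<open>The triangle inequality bounds the integrand by \<open>sqrt \<bar>p\<bar>\<close> times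
  \<open>q' / sqrt \<bar>q\<bar>\<close> plus the same with \<open>p\<close> and \<open>q\<close>
  exchanged, that is, by bounded factors times integrable ones. Only the absolute value of
  \<open>r\<close> is prescribed, so the radicand may change sign.\<close>

lemma interval_integrable_wronskian_over_sqrt:
  fixes p q p' q' :: "real \<Rightarrow> real"
  assumes "a \<le> b"
    and dp: "\<And>t. t \<in> {a..b} \<Longrightarrow> (p has_real_derivative p' t) (at t within {a..b})"
    and dq: "\<And>t. t \<in> {a..b} \<Longrightarrow> (q has_real_derivative q' t) (at t within {a..b})"
    and pos: "\<And>t. t \<in> {a..b} \<Longrightarrow> p' t > 0" "\<And>t. t \<in> {a..b} \<Longrightarrow> q' t > 0"
    and cont: "continuous_on {a..b} p'" "continuous_on {a..b} q'" "continuous_on {a..b} r"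
    and r: "\<And>t. t \<in> {a..b} \<Longrightarrow> \<bar>r t\<bar> = \<bar>p t * q t\<bar>"
  shows "interval_lebesgue_integrable lborel a b (\<lambda>t. (q' t * p t - p' t * q t) / sqrt (r t))"
    (is "interval_lebesgue_integrable _ _ _ ?w")
proof -
  have c: "continuous_on {a..b} p" "continuous_on {a..b} q"
    using DERIV_continuous_on[where D = p', OF dp] DERIV_continuous_on[where D = q', OF dq] by simp_all
  have "\<exists>B. \<forall>t\<in>{a..b}. sqrt \<bar>f t\<bar> \<le> B" if "continuous_on {a..b} f" for f :: "real \<Rightarrow> real"
  proof -
    have "bounded ((\<lambda>t. sqrt \<bar>f t\<bar>) ` {a..b})"
      by (intro compact_imp_bounded compact_continuous_image continuous_intros that compact_Icc)
    then show ?thesis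
      by (simp add: bounded_iff)
  qed
  from this[OF c(1)] this[OF c(2)] obtain P Q
    where PQ: "\<And>t. t \<in> {a..b} \<Longrightarrow> sqrt \<bar>p t\<bar> \<le> P" "\<And>t. t \<in> {a..b} \<Longrightarrow> sqrt \<bar>q t\<bar> \<le> Q"
    by blast
  let ?h = "\<lambda>t. P * (q' t / sqrt \<bar>q t\<bar>) + Q * (p' t / sqrt \<bar>p t\<bar>)"
  \<comment> \<open>The quotient need not be continuous, so numerator and radicand are cut off by
    the indicator separately; off the interval the quotient becomes
    \<open>0 / sqrt 0 = 0\<close>.\<close>
  have meas: "set_borel_measurable borel {a..b} ?w"
  proof -
    have r: "(\<lambda>t. indicator {a..b} t *\<^sub>R r t) \<in> borel_measurable borel"
      by (intro borel_measurable_continuous_on_indicator cont) simp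
    have "(\<lambda>t. indicator {a..b} t *\<^sub>R (q' t * p t - p' t * q t)) \<in> borel_measurable borel"
      by (intro borel_measurable_continuous_on_indicator continuous_intros c cont) simp
    then have "(\<lambda>t. indicator {a..b} t *\<^sub>R (q' t * p t - p' t * q t) / sqrt (indicator {a..b} t *\<^sub>R r t))
        \<in> borel_measurable borel"
      using r by measurable
    moreover have "(\<lambda>t. indicator {a..b} t *\<^sub>R (q' t * p t - p' t * q t) / sqrt (indicator {a..b} t *\<^sub>R r t))
        = (\<lambda>t. indicator {a..b} t *\<^sub>R ?w t)"
      by (rule ext) (simp split: split_indicator)
    ultimately show ?thesis
      by (simp add: set_borel_measurable_def)
  qed
  have h: "?h integrable_on {a..b}"
    using integrable_add[OF integrable_cmul[OF integrable_on_deriv_over_sqrt[OF assms(1) dq pos(2)], of P]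
        integrable_cmul[OF integrable_on_deriv_over_sqrt[OF assms(1) dp pos(1)], of Q]]
    by simp
  have le: "norm (?w t) \<le> ?h t" if t: "t \<in> {a..b}" for t
  proof -
    \<comment> \<open>This also holds for \<open>x = 0\<close> or \<open>z = 0\<close>, where both
      sides are 0 because division by zero gives 0; hence zeros of \<open>p\<close> and
      \<open>q\<close> need no separate case.\<close>
    have *: "\<bar>x\<bar> * y / (sqrt \<bar>x\<bar> * z) = sqrt \<bar>x\<bar> * (y / z)" for x y z :: real
      using times_divide_times_eq[of "\<bar>x\<bar>" "sqrt \<bar>x\<bar>" y z] real_div_sqrt[of "\<bar>x\<bar>"] by simp
    have "\<bar>sqrt (r t)\<bar> = sqrt \<bar>p t\<bar> * sqrt \<bar>q t\<bar>"
      by (simp only: real_sqrt_abs'[symmetric] r[OF t] abs_mult real_sqrt_mult)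
    then have "norm (?w t) = \<bar>q' t * p t - p' t * q t\<bar> / (sqrt \<bar>p t\<bar> * sqrt \<bar>q t\<bar>)"
      by (simp only: real_norm_def abs_divide)
    also have "\<dots> \<le> (\<bar>p t\<bar> * q' t + \<bar>q t\<bar> * p' t) / (sqrt \<bar>p t\<bar> * sqrt \<bar>q t\<bar>)"
    proof (rule divide_right_mono)
      have "\<bar>q' t * p t - p' t * q t\<bar> \<le> \<bar>q' t * p t\<bar> + \<bar>p' t * q t\<bar>" by (rule abs_triangle_ineq4)
      then show "\<bar>q' t * p t - p' t * q t\<bar> \<le> \<bar>p t\<bar> * q' t + \<bar>q t\<bar> * p' t"
        using pos[OF t] by (simp add: abs_mult mult.commute)
    qed simp
    also have "\<dots> = sqrt \<bar>p t\<bar> * (q' t / sqrt \<bar>q t\<bar>) + sqrt \<bar>q t\<bar> * (p' t / sqrt \<bar>p t\<bar>)"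
      unfolding add_divide_distrib
      using *[of "p t" "q' t" "sqrt \<bar>q t\<bar>"] *[of "q t" "p' t" "sqrt \<bar>p t\<bar>"]
      by (simp only: mult.commute[of "sqrt \<bar>q t\<bar>" "sqrt \<bar>p t\<bar>"])
    also have "\<dots> \<le> ?h t"
      by (intro add_mono mult_right_mono PQ t divide_nonneg_nonneg) (use pos[OF t] in auto)
    finally show ?thesis .
  qed
  \<comment> \<open>The dominating function is integrable in the gauge sense, so domination is
    carried out for the completed measure; Borel measurability then leads back to
    \<open>lborel\<close>.\<close>
  have "?w \<in> borel_measurable (lebesgue_on {a..b})"
    using measurable_completion[of _ lborel] meas
    by (simp add: set_borel_measurable_def borel_measurable_restrict_space_iff)
  from measurable_bounded_by_integrable_imp_absolutely_integrable[OF this _ h le]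
  have "?w absolutely_integrable_on {a..b}" by simp
  then have "set_integrable lborel {a..b} ?w"
    using meas unfolding set_integrable_def set_borel_measurable_def by (subst (asm) integrable_completion) simp_all
  then show ?thesis
    unfolding interval_lebesgue_integrable_def
    using set_integrable_subset[of lborel "{a..b}" ?w "{a<..<b}"] \<open>a \<le> b\<close> by (simp add: greaterThanLessThan_subseteq_atLeastAtMost_iff)
qed

subsection \<open>The profile curve\<close>

locale mean_curvature_data =
  fixes I :: "real set" and \<eta> :: real and H :: "real \<Rightarrow> real"
  assumes interval: "is_interval I" and zero: "0 \<in> I" and nontrivial: "I \<noteq> {0}"
    and eta: "\<eta> \<in> {-1, 1}" and cont: "continuous_on I H"
begin

definition \<phi> :: "real \<Rightarrow> real" where
  "\<phi> s = 2 * \<eta> * (LBINT u=0..s. H u)"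

text \<open>Null coordinates of the pair \<open>(g\<^sub>1 + \<eta> a\<^sub>1, f\<^sub>1 + \<eta> a\<^sub>2)\<close>: they factor the radicand, and
  their derivatives \<open>exp (\<plusminus> \<phi>)\<close> are positive.\<close>

definition P :: "real^3 \<Rightarrow> real \<Rightarrow> real" where
  "P a s = (g1 \<eta> H s + \<eta> * a$1) + (f1 \<eta> H s + \<eta> * a$2)"

definition Q :: "real^3 \<Rightarrow> real \<Rightarrow> real" where
  "Q a s = (g1 \<eta> H s + \<eta> * a$1) - (f1 \<eta> H s + \<eta> * a$2)"

text \<open>The Wronskian \<open>Q' P - P' Q\<close> over the root of the radicand. The integrand
  for the third component of the curve is \<open>\<eta> / 2\<close> times it.\<close>

definition W :: "real^3 \<Rightarrow> real \<Rightarrow> real" where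
  "W a s = (exp (- \<phi> s) * P a s - exp (\<phi> s) * Q a s) / sqrt (radicand \<eta> H a s)"

lemma eta_sq: "\<eta> * \<eta> = 1"
  using eta by auto

text \<open>A connected set with more than one point has no isolated points; this makes derivatives
  within \<open>I\<close> unique.\<close>

lemma limpt: "s \<in> I \<Longrightarrow> s islimpt I"
  using connected_imp_perfect[of I s] interval zero nontrivial by (auto simp: is_interval_connected_1)

lemma D_unique:
  assumes "(f has_real_derivative a) (at s within I)" "(f has_real_derivative b) (at s within I)" "s \<in> I"
  shows "a = b"
  using assms D_eqI limpt unfolding has_real_derivative_iff_has_vector_derivative by blast

lemma phi_deriv: "s \<in> I \<Longrightarrow> (\<phi> has_real_derivative 2 * \<eta> * H s) (at s within I)"
  using DERIV_cmult[OF LBINT_has_real_derivative_continuous[OF interval zero cont], of s "2 * \<eta>"]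
  by (simp add: \<phi>_def[abs_def] zero_ereal_def)

lemma phi_cont: "continuous_on I \<phi>"
  by (rule DERIV_continuous_on[where D = "\<lambda>s. 2 * \<eta> * H s"]) (rule phi_deriv)

lemma at_0: "\<phi> 0 = 0" "g1 \<eta> H 0 = 0" "f1 \<eta> H 0 = 0"
  by (simp_all add: \<phi>_def f1_def g1_def flip: zero_ereal_def)

lemma g1_f1_deriv:
  assumes "s \<in> I"
  shows "(g1 \<eta> H has_real_derivative cosh (\<phi> s)) (at s within I)"
    and "(f1 \<eta> H has_real_derivative sinh (\<phi> s)) (at s within I)"
proof -
  have "continuous_on I (\<lambda>s. cosh (\<phi> s))" "continuous_on I (\<lambda>s. sinh (\<phi> s))"
    by (auto intro!: continuous_intros phi_cont)
  note this[THEN LBINT_has_real_derivative_continuous[OF interval zero], OF assms]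
  then show "(g1 \<eta> H has_real_derivative cosh (\<phi> s)) (at s within I)"
    and "(f1 \<eta> H has_real_derivative sinh (\<phi> s)) (at s within I)"
    by (simp_all add: g1_def[abs_def] f1_def[abs_def] \<phi>_def zero_ereal_def)
qed

lemma D_g1_f1:
  assumes "s \<in> I"
  shows "D I (g1 \<eta> H) s = cosh (\<phi> s)" "D I (f1 \<eta> H) s = sinh (\<phi> s)"
  using g1_f1_deriv[OF assms] limpt[OF assms]
  by (auto simp: has_real_derivative_iff_has_vector_derivative intro: D_eqI)

lemma P_Q_deriv:
  assumes "s \<in> I"
  shows "(P a has_real_derivative exp (\<phi> s)) (at s within I)"
    and "(Q a has_real_derivative exp (- \<phi> s)) (at s within I)"
  unfolding P_def[abs_def] Q_def[abs_def] cosh_plus_sinh[symmetric] cosh_minus_sinh[symmetric]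
  by (auto intro!: derivative_eq_intros g1_f1_deriv assms)

lemma P_Q_cont: "continuous_on I (P a)" "continuous_on I (Q a)"
  using DERIV_continuous_on[where D = "\<lambda>s. exp (\<phi> s)", OF P_Q_deriv(1)]
    DERIV_continuous_on[where D = "\<lambda>s. exp (- \<phi> s)", OF P_Q_deriv(2)] by simp_all

lemma P_Q_0: "P a 0 = \<eta> * (a$1 + a$2)" "Q a 0 = \<eta> * (a$1 - a$2)"
  by (simp_all add: P_def Q_def at_0 algebra_simps)

lemma radicand_eq: "radicand \<eta> H a s = \<eta> * (P a s * Q a s)"
  unfolding radicand_def P_def Q_def by algebra

lemma radicand_cont: "continuous_on I (radicand \<eta> H a)"
  unfolding radicand_eq[abs_def] by (intro continuous_intros P_Q_cont)

lemma curve_nth: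
  assumes "s \<in> I"
  shows "curve I \<eta> H a s $ 1 = sqrt (radicand \<eta> H a s)" "curve I \<eta> H a s $ 2 = 0"
    and "curve I \<eta> H a s $ 3 = (LBINT t=0..s. \<eta> / 2 * W a t) + a$3"
proof -
  have "(LBINT t=0..s. \<eta> * ((D I (g1 \<eta> H) t * (f1 \<eta> H t + \<eta> * a$2)
      - D I (f1 \<eta> H) t * (g1 \<eta> H t + \<eta> * a$1)) / sqrt (radicand \<eta> H a t)))
    = (LBINT t=0..s. \<eta> / 2 * W a t)"
  proof (rule interval_integral_cong)
    \<comment> \<open>The derivatives of \<open>g1\<close> and \<open>f1\<close> are known only on
      \<open>I\<close>, so the integrands are compared only between 0 and \<open>s\<close>.\<close>
    fix t assume "t \<in> einterval (min 0 (ereal s)) (max 0 (ereal s))"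
    then have "min 0 s \<le> t" "t \<le> max 0 s"
      by (auto simp: einterval_def min_def max_def zero_ereal_def split: if_splits)
    moreover have "min 0 s \<in> I" "max 0 s \<in> I"
      using assms zero by (auto simp: min_def max_def)
    ultimately have t: "t \<in> I"
      using interval mem_is_interval_1_I by blast
    have e: "cosh (\<phi> t) * (f1 \<eta> H t + \<eta> * a$2) - sinh (\<phi> t) * (g1 \<eta> H t + \<eta> * a$1)
        = (exp (- \<phi> t) * P a t - exp (\<phi> t) * Q a t) / 2"
      unfolding P_def Q_def cosh_plus_sinh[symmetric, of "\<phi> t"] cosh_minus_sinh[symmetric]
      by (simp add: field_simps)
    show "\<eta> * ((D I (g1 \<eta> H) t * (f1 \<eta> H t + \<eta> * a$2)
      - D I (f1 \<eta> H) t * (g1 \<eta> H t + \<eta> * a$1)) / sqrt (radicand \<eta> H a t)) = \<eta> / 2 * W a t"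
      unfolding D_g1_f1[OF t] e W_def by simp
  qed
  then show "curve I \<eta> H a s $ 3 = (LBINT t=0..s. \<eta> / 2 * W a t) + a$3"
    by (simp add: curve_def)
qed (simp_all add: curve_def)

text \<open>The segment may cross zeros of the radicand, where \<open>W\<close> can be unbounded;
  monotonicity of \<open>P a\<close> and \<open>Q a\<close> still gives integrability.\<close>

lemma W_integrable:
  assumes "{c..d} \<subseteq> I" "c \<le> d"
  shows "interval_lebesgue_integrable lborel c d (\<lambda>t. \<eta> / 2 * W a t)"
proof -
  have "interval_lebesgue_integrable lborel c d (W a)"
    unfolding W_def[abs_def]
  proof (rule interval_integrable_wronskian_over_sqrt[OF assms(2)])
    show "(P a has_real_derivative exp (\<phi> t)) (at t within {c..d})"
      and "(Q a has_real_derivative exp (- \<phi> t)) (at t within {c..d})"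
      and "\<bar>radicand \<eta> H a t\<bar> = \<bar>P a t * Q a t\<bar>" if "t \<in> {c..d}" for t
      using that P_Q_deriv[THEN DERIV_subset, OF _ assms(1)] assms(1) eta
      by (auto simp: radicand_eq abs_mult)
  qed (auto intro!: continuous_intros continuous_on_subset[OF phi_cont assms(1)]
      continuous_on_subset[OF radicand_cont assms(1)])
  then show ?thesis
    by (rule interval_lebesgue_integrable_mult_right)
qed

section \<open>The converse: the explicit curve has mean curvature \<open>H\<close>\<close>

lemma curve_domain_eq:
  obtains T where "open T" "curve_domain I \<eta> H a = I \<inter> T"
proof -
  obtain T where "open T" "T \<inter> I = radicand \<eta> H a -` {0<..} \<inter> I"
    using radicand_cont[of a] unfolding continuous_on_open_invariant by (meson open_greaterThan)
  moreover from this have "curve_domain I \<eta> H a = I \<inter> T"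
    unfolding curve_domain_def by blast
  ultimately show thesis using that by blast
qed

lemma curve_domain_limpt:
  assumes "s \<in> curve_domain I \<eta> H a"
  shows "s islimpt curve_domain I \<eta> H a"
proof -
  obtain T where T: "open T" "curve_domain I \<eta> H a = I \<inter> T"
    using curve_domain_eq .
  show ?thesis
    unfolding T(2)
  proof (rule islimptI)
    fix V assume "s \<in> V" "open V"
    then show "\<exists>y\<in>I \<inter> T. y \<in> V \<and> y \<noteq> s"
      using islimptE[OF limpt, of s "T \<inter> V"] assms T by (metis IntD1 IntD2 IntI open_Int)
  qed
qed

text \<open>The products \<open>A\<close> and \<open>B\<close> satisfy linear equations with
  coefficients \<open>\<mp> 2 \<eta> H\<close>, and the squared radius is \<open>\<eta> A B\<close>.
  Unit speed and the curvature equation then become algebraic identities.\<close>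

lemma curve_generates:
  "generates (curve_domain I \<eta> H a) \<eta> H (curve I \<eta> H a)"
proof -
  define U where "U = curve_domain I \<eta> H a"
  define x where "x s = sqrt (radicand \<eta> H a s)" for s
  define A where "A s = exp (- \<phi> s) * P a s" for s
  define B where "B s = exp (\<phi> s) * Q a s" for s
  \<comment> \<open>These solve \<open>x (x' + z') = \<eta> A\<close> and
    \<open>x (x' - z') = \<eta> B\<close> for \<open>x'\<close> and \<open>z'\<close>.\<close>
  define x1 where "x1 s = \<eta> * (A s + B s) / (2 * x s)" for s
  define z1 where "z1 s = \<eta> * (A s - B s) / (2 * x s)" for s
  \<comment> \<open>Both second derivatives come from differentiating
    \<open>x x1 = \<eta> (A + B) / 2\<close> and \<open>x z1 = \<eta> (A - B) / 2\<close>, with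
    \<open>A\<close> and \<open>B\<close> then expressed through \<open>x1\<close> and
    \<open>z1\<close>.\<close>
  define x2 where "x2 s = \<eta> / x s - 2 * \<eta> * H s * z1 s - (x1 s)\<^sup>2 / x s" for s
  define z2 where "z2 s = - 2 * \<eta> * H s * x1 s - z1 s * x1 s / x s" for s
  let ?\<alpha> = "curve I \<eta> H a"
  let ?\<beta> = "\<lambda>s. vector [x1 s, 0, z1 s] :: real^3" and ?\<gamma> = "\<lambda>s. vector [x2 s, 0, z2 s] :: real^3"
  have U: "U \<subseteq> I" and lim: "\<And>s. s \<in> U \<Longrightarrow> s islimpt U"
    using curve_domain_limpt by (auto simp: U_def curve_domain_def)
  have pos: "x s > 0" if "s \<in> U" for s
    using that by (simp add: x_def U_def curve_domain_def)
  have AB: "A s * B s = P a s * Q a s" for s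
    by (simp add: A_def B_def exp_minus field_simps)
  have x_sq: "(x s)\<^sup>2 = \<eta> * (A s * B s)" if "s \<in> U" for s
    using that by (simp add: x_def U_def curve_domain_def AB radicand_eq)
  have arc: "(x1 s)\<^sup>2 - (z1 s)\<^sup>2 = \<eta>" if "s \<in> U" for s
  proof -
    have "(x1 s)\<^sup>2 - (z1 s)\<^sup>2 = A s * B s / (x s)\<^sup>2"
      using eta pos[OF that] by (auto simp: x1_def z1_def power2_eq_square field_simps)
    then show ?thesis
      using x_sq[OF that] pos[OF that] eta by (auto simp: field_simps)
  qed
  have dA: "(A has_real_derivative 1 - 2 * \<eta> * H s * A s) (at s within U)"
    and dB: "(B has_real_derivative 1 + 2 * \<eta> * H s * B s) (at s within U)" if "s \<in> U" for s
  proof -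
    have s: "s \<in> I" using that U by blast
    show "(A has_real_derivative 1 - 2 * \<eta> * H s * A s) (at s within U)"
      unfolding A_def[abs_def]
      by (rule DERIV_subset[OF _ U])
        (auto intro!: derivative_eq_intros phi_deriv P_Q_deriv s simp: exp_minus field_simps)
    show "(B has_real_derivative 1 + 2 * \<eta> * H s * B s) (at s within U)"
      unfolding B_def[abs_def]
      by (rule DERIV_subset[OF _ U])
        (auto intro!: derivative_eq_intros phi_deriv P_Q_deriv s simp: exp_minus field_simps)
  qed
  have dx: "(x has_real_derivative x1 s) (at s within U)" if "s \<in> U" for s
  proof -
    have "x t = sqrt (\<eta> * (A t * B t))" for t
      by (simp add: x_def radicand_eq AB)
    then have x: "x = (\<lambda>t. sqrt (\<eta> * (A t * B t)))" by blast
    have "\<eta> * (A s * B s) > 0" using pos[OF that] x_sq[OF that] by (metis zero_less_power)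
    then show ?thesis
      unfolding x x1_def
      by (auto intro!: derivative_eq_intros dA dB that simp: field_simps)
  qed
  have dx1: "(x1 has_real_derivative x2 s) (at s within U)"
    and dz1: "(z1 has_real_derivative z2 s) (at s within U)" if "s \<in> U" for s
    using pos[OF that] unfolding x1_def[abs_def] z1_def[abs_def]
    by (auto intro!: derivative_eq_intros dA dB dx that
        simp: x2_def z2_def x1_def z1_def field_simps power2_eq_square)
  have dz: "((\<lambda>s. (LBINT t=0..s. \<eta> / 2 * W a t) + a$3) has_real_derivative z1 s) (at s within U)"
    if s: "s \<in> U" for s
  proof -
    obtain T where T: "open T" "curve_domain I \<eta> H a = I \<inter> T"
      using curve_domain_eq .
    have "continuous_on (I \<inter> T) (\<lambda>t. \<eta> / 2 * W a t)"
      unfolding W_def T(2)[symmetric]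
      by (intro continuous_intros continuous_on_subset[OF phi_cont] continuous_on_subset[OF P_Q_cont(1)]
          continuous_on_subset[OF P_Q_cont(2)] continuous_on_subset[OF radicand_cont])
        (auto simp: curve_domain_def)
    from LBINT_has_real_derivative[OF interval zero W_integrable T(1) this] s
    have "((\<lambda>s. LBINT t=0..s. \<eta> / 2 * W a t) has_real_derivative \<eta> / 2 * W a s) (at s within I)"
      by (simp add: U_def T(2) zero_ereal_def)
    moreover have "\<eta> / 2 * W a s = z1 s"
      by (simp add: W_def z1_def A_def B_def x_def)
    ultimately have "((\<lambda>s. LBINT t=0..s. \<eta> / 2 * W a t) has_real_derivative z1 s) (at s within I)"
      by (simp only:)
    from DERIV_add[OF DERIV_subset[OF this U] DERIV_const[of "a$3"]] show ?thesis
      by (simp only: add_0_right)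
  qed
  have d: "(?\<alpha> has_vector_derivative ?\<beta> s) (at s within U)" if "s \<in> U" for s
  proof (rule has_vector_derivative_transform[OF that _ has_vector_derivative_vector_3[OF dx[OF that] _ dz[OF that]]])
    show "?\<alpha> t = vector [x t, 0, (LBINT t=0..t. \<eta> / 2 * W a t) + a$3]" if "t \<in> U" for t
      using curve_nth[of t a] that U by (auto simp: vec_eq_iff forall_3 x_def)
  qed simp
  have d': "(?\<beta> has_vector_derivative ?\<gamma> s) (at s within U)" if "s \<in> U" for s
    by (intro has_vector_derivative_vector_3 dx1 dz1 that) simp
  have c: "continuous_on U x" "continuous_on U x1" "continuous_on U z1"
    using DERIV_continuous_on[where D = x1, OF dx] DERIV_continuous_on[where D = x2, OF dx1]
      DERIV_continuous_on[where D = z2, OF dz1] by simp_all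
  have "continuous_on U x2" "continuous_on U z2"
    unfolding x2_def[abs_def] z2_def[abs_def]
    by (intro continuous_intros c continuous_on_subset[OF cont U]; use pos in force)+
  then have c': "continuous_on U ?\<gamma>"
    by (intro continuous_intros)
  have nth: "?\<alpha> s $ 1 = x s" "?\<alpha> s $ 2 = 0" if "s \<in> U" for s
    using curve_nth[of s a] U that by (auto simp: x_def)
  have D: "D U ?\<alpha> s = ?\<beta> s" if "s \<in> U" for s
    using D_eqI[OF d lim] that by blast
  have "mean_curvature U UNIV (rot_surface ?\<alpha>) (rot_normal U ?\<alpha>) s \<theta> = H s" if s: "s \<in> U" for s \<theta>
  proof -
    have "mean_curvature U UNIV (rot_surface ?\<alpha>) (rot_normal U ?\<alpha>) s \<theta>
        = - (\<eta> * z1 s / x s + z2 s * x1 s - x2 s * z1 s) / 2"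
      using rot_mean_curvature[OF lim d d' c' s, where \<eta> = \<eta>] arc eta pos s nth[OF s] by simp
    \<comment> \<open>All terms with \<open>x s\<close> in the denominator cancel; unit speed turns
      the rest into \<open>- 2 * H s\<close>.\<close>
    also have "\<eta> * z1 s / x s + z2 s * x1 s - x2 s * z1 s = - 2 * \<eta> * H s * ((x1 s)\<^sup>2 - (z1 s)\<^sup>2)"
      using pos[OF s] by (simp add: x2_def z2_def field_simps power2_eq_square)
    finally show ?thesis
      using eta by (auto simp: arc[OF s])
  qed
  moreover have "lorentz (D U ?\<alpha> s) (D U ?\<alpha> s) = \<eta>" if "s \<in> U" for s
    using arc[OF that] by (simp add: D that lorentz_def power2_eq_square)
  ultimately show ?thesis
    unfolding generates_def U_def[symmetric]
    using C2_curveI[OF lim d d' c'] rot_surface_C2(1)[OF lim d d' c'] nth pos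
      continuous_on_subset[OF cont U] by simp
qed

section \<open>The direct part: a curve of mean curvature \<open>H\<close> is the explicit
  one\<close>

context
  fixes \<alpha> :: "real \<Rightarrow> real^3"
  assumes gen: "generates I \<eta> H \<alpha>"
begin

lemma generating_curve_deriv:
  assumes "s \<in> I"
  shows "(\<alpha> has_vector_derivative D I \<alpha> s) (at s within I)"
    and "(D I \<alpha> has_vector_derivative D I (D I \<alpha>) s) (at s within I)"
  using C2_curveE gen assms by (auto simp: generates_def)

lemma generating_curve_nth_deriv:
  assumes "s \<in> I"
  shows "((\<lambda>s. \<alpha> s $ i) has_real_derivative D I \<alpha> s $ i) (at s within I)"
    and "((\<lambda>s. D I \<alpha> s $ i) has_real_derivative D I (D I \<alpha>) s $ i) (at s within I)"
  using generating_curve_deriv[OF assms] by (auto intro: has_vector_derivative_vec_nth)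

lemma generating_curve_props:
  assumes "s \<in> I"
  shows "\<alpha> s $ 1 > 0" "\<alpha> s $ 2 = 0" "D I \<alpha> s $ 2 = 0"
    and "(D I \<alpha> s $ 1)\<^sup>2 - (D I \<alpha> s $ 3)\<^sup>2 = \<eta>"
proof -
  show "\<alpha> s $ 1 > 0" "\<alpha> s $ 2 = 0"
    using gen assms by (auto simp: generates_def)
  have "((\<lambda>s. \<alpha> s $ 2) has_real_derivative 0) (at s within I)"
    using has_field_derivative_transform_within[OF DERIV_const zero_less_one assms] gen
    by (simp add: generates_def)
  then show 2: "D I \<alpha> s $ 2 = 0"
    using D_unique generating_curve_nth_deriv(1) assms by blast
  have "lorentz (D I \<alpha> s) (D I \<alpha> s) = \<eta>"
    using gen assms by (auto simp: generates_def)
  then show "(D I \<alpha> s $ 1)\<^sup>2 - (D I \<alpha> s $ 3)\<^sup>2 = \<eta>"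
    by (simp add: lorentz_def 2 power2_eq_square)
qed

text \<open>Differentiated unit speed and the curvature equation are two linear equations for the
  second derivatives. Their determinant is \<open>x'\<^sup>2 - z'\<^sup>2 = \<eta>\<close>, so
  multiplying by \<eta> solves them.\<close>

lemma generating_curve_ode:
  assumes s: "s \<in> I"
  defines "K \<equiv> - 2 * H s - \<eta> * D I \<alpha> s $ 3 / \<alpha> s $ 1"
  shows "D I (D I \<alpha>) s $ 1 = \<eta> * D I \<alpha> s $ 3 * K" "D I (D I \<alpha>) s $ 3 = \<eta> * D I \<alpha> s $ 1 * K"
proof -
  let ?x1 = "D I \<alpha> s $ 1" and ?z1 = "D I \<alpha> s $ 3"
  let ?x2 = "D I (D I \<alpha>) s $ 1" and ?z2 = "D I (D I \<alpha>) s $ 3"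
  have arc: "?x1 * ?x1 - ?z1 * ?z1 = \<eta>"
    using generating_curve_props(4)[OF s] by (simp add: power2_eq_square)
  have "((\<lambda>s. (D I \<alpha> s $ 1)\<^sup>2 - (D I \<alpha> s $ 3)\<^sup>2) has_real_derivative 2 * (?x1 * ?x2 - ?z1 * ?z2)) (at s within I)"
    by (auto intro!: derivative_eq_intros generating_curve_nth_deriv s)
  moreover have "((\<lambda>s. (D I \<alpha> s $ 1)\<^sup>2 - (D I \<alpha> s $ 3)\<^sup>2) has_real_derivative 0) (at s within I)"
    using has_field_derivative_transform_within[OF DERIV_const zero_less_one s] generating_curve_props(4)
    by simp
  ultimately have orth: "?x1 * ?x2 = ?z1 * ?z2"
    using D_unique s by fastforce
  have "continuous_on I (D I (D I \<alpha>))"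
    using gen by (simp add: generates_def C2_curve_def C1_curve_def)
  from rot_mean_curvature[OF limpt generating_curve_deriv this s generating_curve_props(1,4)[OF s] eta]
  have "- (\<eta> * ?z1 / \<alpha> s $ 1 + ?z2 * ?x1 - ?x2 * ?z1) / 2 = H s"
    using gen s by (simp add: generates_def)
  then have K: "?z2 * ?x1 - ?x2 * ?z1 = K"
    by (simp add: K_def)
  have "\<eta> * ?x2 = ?x1 * (?x1 * ?x2) - ?z1 * ?z1 * ?x2"
    unfolding arc[symmetric] by (simp add: algebra_simps)
  also have "\<dots> = ?z1 * K"
    unfolding orth K[symmetric] by (simp add: algebra_simps)
  finally have "\<eta> * ?x2 = ?z1 * K" .
  moreover have "\<eta> * ?z2 = ?x1 * ?x1 * ?z2 - ?z1 * (?z1 * ?z2)"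
    unfolding arc[symmetric] by (simp add: algebra_simps)
  then have "\<eta> * ?z2 = ?x1 * K"
    unfolding orth[symmetric] K[symmetric] by (simp add: algebra_simps)
  ultimately show "?x2 = \<eta> * ?z1 * K" "?z2 = \<eta> * ?x1 * K"
    using eta by auto
qed

text \<open>Unit speed gives \<open>\<eta> (a\<^sub>1\<^sup>2 - a\<^sub>2\<^sup>2) =
  x(0)\<^sup>2\<close>, so the root is \<open>x(0)\<close> and the power its inverse. The conditions
  thus single out one explicit vector, which settles existence and uniqueness.\<close>

lemma initial_conditions_iff:
  "initial_conditions I \<eta> \<alpha> a \<longleftrightarrow>
    a = vector [\<alpha> 0 $ 1 * D I \<alpha> 0 $ 1, \<alpha> 0 $ 1 * D I \<alpha> 0 $ 3, \<alpha> 0 $ 3]"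
proof -
  note p = generating_curve_props[OF zero]
  let ?c = "\<eta> * ((a$1)\<^sup>2 - (a$2)\<^sup>2)"
  have powr: "c powr (- 1 / 2) = inverse (sqrt c)" if "c > 0" for c :: real
    using that by (simp add: powr_minus powr_half_sqrt)
  show ?thesis
  proof
    assume "initial_conditions I \<eta> \<alpha> a"
    then have 1: "\<alpha> 0 = vector [sqrt ?c, 0, a$3]"
      and 2: "D I \<alpha> 0 = ?c powr (- 1/2) *\<^sub>R vector [a$1, 0, a$2]"
      by (simp_all add: initial_conditions_def)
    have c: "?c > 0"
      using p(1) unfolding 1 by simp
    then obtain r where r: "sqrt ?c = r" "r > 0"
      by simp
    show "a = vector [\<alpha> 0 $ 1 * D I \<alpha> 0 $ 1, \<alpha> 0 $ 1 * D I \<alpha> 0 $ 3, \<alpha> 0 $ 3]"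
      unfolding 1 2 powr[OF c] r(1) using r(2) by (simp add: vec_eq_iff forall_3)
  next
    assume a: "a = vector [\<alpha> 0 $ 1 * D I \<alpha> 0 $ 1, \<alpha> 0 $ 1 * D I \<alpha> 0 $ 3, \<alpha> 0 $ 3]"
    have "?c = (\<alpha> 0 $ 1)\<^sup>2 * (\<eta> * ((D I \<alpha> 0 $ 1)\<^sup>2 - (D I \<alpha> 0 $ 3)\<^sup>2))"
      by (simp add: a power2_eq_square algebra_simps)
    then have c: "?c = (\<alpha> 0 $ 1)\<^sup>2"
      by (simp add: p eta_sq)
    have "?c > 0" unfolding c using p by simp
    then show "initial_conditions I \<eta> \<alpha> a"
      unfolding initial_conditions_def powr[OF \<open>?c > 0\<close>] unfolding c
      using p by (simp add: vec_eq_iff forall_3 a)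
  qed
qed

text \<open>The function \<open>y = x (x' \<plusminus> z')\<close> solves \<open>y' = \<eta> \<mp> \<phi>' y\<close>, so multiplying it by the integrating
  factor \<open>exp (\<plusminus> \<phi>)\<close> yields the same derivative as that of \<open>\<eta> P\<close> or \<open>\<eta> Q\<close>.\<close>

lemma generating_curve_first_integrals:
  assumes init: "initial_conditions I \<eta> \<alpha> a" and s: "s \<in> I"
  shows "\<alpha> s $ 1 * (D I \<alpha> s $ 1 + D I \<alpha> s $ 3) * exp (\<phi> s) = \<eta> * P a s"
    and "\<alpha> s $ 1 * (D I \<alpha> s $ 1 - D I \<alpha> s $ 3) * exp (- \<phi> s) = \<eta> * Q a s"
proof -
  let ?x = "\<lambda>s. \<alpha> s $ 1" and ?x1 = "\<lambda>s. D I \<alpha> s $ 1" and ?z1 = "\<lambda>s. D I \<alpha> s $ 3"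
  let ?f = "\<lambda>s. ?x s * (?x1 s + ?z1 s) * exp (\<phi> s) - \<eta> * P a s"
  let ?g = "\<lambda>s. ?x s * (?x1 s - ?z1 s) * exp (- \<phi> s) - \<eta> * Q a s"
  have d: "(?f has_real_derivative 0) (at s within I) \<and> (?g has_real_derivative 0) (at s within I)"
    if s: "s \<in> I" for s
  proof -
    let ?x2 = "D I (D I \<alpha>) s $ 1" and ?z2 = "D I (D I \<alpha>) s $ 3"
    define K where "K = - 2 * H s - \<eta> * ?z1 s / ?x s"
    have ode: "?x2 = \<eta> * ?z1 s * K" "?z2 = \<eta> * ?x1 s * K"
      using generating_curve_ode[OF s] by (simp_all add: K_def)
    have xK: "?x s * K = - 2 * H s * ?x s - \<eta> * ?z1 s"
      using generating_curve_props(1)[OF s] by (simp add: K_def field_simps)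
    have arc: "(?x1 s)\<^sup>2 - (?z1 s)\<^sup>2 = \<eta>"
      using generating_curve_props(4)[OF s] .
    \<comment> \<open>Inserting the second derivatives cancels the terms with \<open>H\<close> and
      leaves \<open>(x' - z') (x' + z') = \<eta>\<close>.\<close>
    have "?x1 s * (?x1 s + ?z1 s) + ?x s * (?x2 + ?z2) + ?x s * (?x1 s + ?z1 s) * (2 * \<eta> * H s) - \<eta> = 0"
      using ode xK arc eta_sq by algebra
    then have "(?x1 s * (?x1 s + ?z1 s) + ?x s * (?x2 + ?z2) + ?x s * (?x1 s + ?z1 s) * (2 * \<eta> * H s) - \<eta>)
        * exp (\<phi> s) = 0"
      by simp
    then have 1: "(?x1 s * (?x1 s + ?z1 s) + (?x2 + ?z2) * ?x s) * exp (\<phi> s)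
        + exp (\<phi> s) * (2 * \<eta> * H s) * (?x s * (?x1 s + ?z1 s)) - \<eta> * exp (\<phi> s) = 0"
      by (simp add: algebra_simps)
    have "?x1 s * (?x1 s - ?z1 s) + ?x s * (?x2 - ?z2) - ?x s * (?x1 s - ?z1 s) * (2 * \<eta> * H s) - \<eta> = 0"
      using ode xK arc eta_sq by algebra
    then have "(?x1 s * (?x1 s - ?z1 s) + ?x s * (?x2 - ?z2) - ?x s * (?x1 s - ?z1 s) * (2 * \<eta> * H s) - \<eta>)
        * exp (- \<phi> s) = 0"
      by simp
    then have 2: "(?x1 s * (?x1 s - ?z1 s) + (?x2 - ?z2) * ?x s) * exp (- \<phi> s)
        + exp (- \<phi> s) * - (2 * \<eta> * H s) * (?x s * (?x1 s - ?z1 s)) - \<eta> * exp (- \<phi> s) = 0"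
      by (simp add: algebra_simps)
    have e: "((\<lambda>s. exp (\<phi> s)) has_real_derivative exp (\<phi> s) * (2 * \<eta> * H s)) (at s within I)"
      "((\<lambda>s. exp (- \<phi> s)) has_real_derivative exp (- \<phi> s) * - (2 * \<eta> * H s)) (at s within I)"
      by (auto intro!: derivative_eq_intros phi_deriv s)
    have "(?f has_real_derivative (?x1 s * (?x1 s + ?z1 s) + (?x2 + ?z2) * ?x s) * exp (\<phi> s)
        + exp (\<phi> s) * (2 * \<eta> * H s) * (?x s * (?x1 s + ?z1 s)) - \<eta> * exp (\<phi> s)) (at s within I)"
      by (intro DERIV_diff DERIV_mult DERIV_add DERIV_cmult e P_Q_deriv
          generating_curve_nth_deriv s)
    moreover have "(?g has_real_derivative (?x1 s * (?x1 s - ?z1 s) + (?x2 - ?z2) * ?x s) * exp (- \<phi> s)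
        + exp (- \<phi> s) * - (2 * \<eta> * H s) * (?x s * (?x1 s - ?z1 s)) - \<eta> * exp (- \<phi> s)) (at s within I)"
      by (intro DERIV_diff DERIV_mult DERIV_cmult e P_Q_deriv
          generating_curve_nth_deriv s)
    ultimately show ?thesis
      unfolding 1 2 by blast
  qed
  have "convex I"
    using interval by (simp add: is_interval_convex_1)
  obtain c c' where c: "\<And>s. s \<in> I \<Longrightarrow> ?f s = c" "\<And>s. s \<in> I \<Longrightarrow> ?g s = c'"
    using has_field_derivative_zero_constant[OF \<open>convex I\<close>, of ?f]
      has_field_derivative_zero_constant[OF \<open>convex I\<close>, of ?g] d by blast
  have "a$1 = ?x 0 * ?x1 0" "a$2 = ?x 0 * ?z1 0"
    using init unfolding initial_conditions_iff by simp_all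
  then have "?f 0 = 0" "?g 0 = 0"
    using eta by (auto simp: at_0 P_Q_0 algebra_simps)
  then show "?x s * (?x1 s + ?z1 s) * exp (\<phi> s) = \<eta> * P a s"
    and "?x s * (?x1 s - ?z1 s) * exp (- \<phi> s) = \<eta> * Q a s"
    using c[OF zero] c[OF s] by simp_all
qed

text \<open>The product of the first integrals gives the squared radius and their difference gives
  \<open>z'\<close>. The radicand is therefore positive on all of \<open>I\<close>, and the height
  follows from the fundamental theorem without singularities.\<close>

lemma generating_curve_eq:
  assumes init: "initial_conditions I \<eta> \<alpha> a" and s: "s \<in> I"
  shows "\<alpha> s = curve I \<eta> H a s"
proof -
  let ?x = "\<lambda>s. \<alpha> s $ 1" and ?x1 = "\<lambda>s. D I \<alpha> s $ 1" and ?z1 = "\<lambda>s. D I \<alpha> s $ 3"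
  have x: "sqrt (radicand \<eta> H a s) = ?x s" and z: "\<eta> / 2 * W a s = ?z1 s" if s: "s \<in> I" for s
  proof -
    note F = generating_curve_first_integrals[OF init s]
    have e: "exp (- \<phi> s) * exp (\<phi> s) = 1" by (simp add: exp_minus)
    have "radicand \<eta> H a s = (?x s)\<^sup>2"
      unfolding radicand_eq using F e generating_curve_props(4)[OF s] eta_sq by algebra
    then show x: "sqrt (radicand \<eta> H a s) = ?x s"
      using generating_curve_props(1)[OF s] by simp
    have "exp (- \<phi> s) * P a s - exp (\<phi> s) * Q a s = 2 * \<eta> * ?z1 s * ?x s"
      using F e eta_sq by algebra
    then show "\<eta> / 2 * W a s = ?z1 s"
      using generating_curve_props(1)[OF s] eta by (auto simp: W_def x)
  qed
  have sub: "{min 0 s..max 0 s} \<subseteq> I"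
  proof -
    have "min 0 s \<in> I" "max 0 s \<in> I"
      using s zero by (auto simp: min_def max_def)
    then show ?thesis
      by (meson atLeastAtMost_iff subsetI mem_is_interval_1_I[OF interval])
  qed
  have "(LBINT t=ereal 0..s. \<eta> / 2 * W a t) = \<alpha> s $ 3 - \<alpha> 0 $ 3"
  proof (rule interval_integral_FTC_finite)
    \<comment> \<open>Continuity of the integrand is inherited from \<open>z'\<close>, with which it
      agrees on \<open>I\<close>.\<close>
    have "continuous_on {min 0 s..max 0 s} ?z1"
      by (rule continuous_on_subset[OF _ sub])
        (rule DERIV_continuous_on[where D = "\<lambda>s. D I (D I \<alpha>) s $ 3"], rule generating_curve_nth_deriv)
    then show "continuous_on {min 0 s..max 0 s} (\<lambda>t. \<eta> / 2 * W a t)"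
      by (rule continuous_on_eq) (use z sub in auto)
    fix t assume "min 0 s \<le> t" "t \<le> max 0 s"
    then have "t \<in> I" using sub by auto
    then show "((\<lambda>s. \<alpha> s $ 3) has_vector_derivative \<eta> / 2 * W a t) (at t within {min 0 s..max 0 s})"
      unfolding z[OF \<open>t \<in> I\<close>] has_real_derivative_iff_has_vector_derivative[symmetric]
      by (intro DERIV_subset[OF _ sub] generating_curve_nth_deriv)
  qed
  moreover have "a$3 = \<alpha> 0 $ 3"
    using init unfolding initial_conditions_iff by simp
  ultimately have "curve I \<eta> H a s $ 3 = \<alpha> s $ 3"
    using curve_nth(3)[OF s, of a] unfolding zero_ereal_def by linarith
  then show ?thesis
    using curve_nth(1,2)[OF s, of a] x[OF s] generating_curve_props(2)[OF s]
    by (simp add: vec_eq_iff forall_3)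
qed

end

end

theorem theorem2p2:
  fixes I :: "real set" and \<eta> :: real and H :: "real \<Rightarrow> real"
  assumes "is_interval I" and "0 \<in> I" and "I \<noteq> {0}"
    and "\<eta> \<in> {-1, 1}"
    and "continuous_on I H"
  shows "(\<forall>\<alpha>. generates I \<eta> H \<alpha> \<longrightarrow>
            (\<exists>!a. initial_conditions I \<eta> \<alpha> a) \<and>
            (\<forall>a. initial_conditions I \<eta> \<alpha> a \<longrightarrow> (\<forall>s\<in>I. \<alpha> s = curve I \<eta> H a s)))
       \<and> (\<forall>a. (a$1, a$2) \<in> S1 I \<eta> H \<longrightarrow>
            generates (curve_domain I \<eta> H a) \<eta> H (curve I \<eta> H a))"
proof -
  interpret mean_curvature_data I \<eta> H
    using assms by unfold_locales
  show ?thesis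
    using initial_conditions_iff generating_curve_eq curve_generates by simp
qed

end
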